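(* Let $1\le k\le n$, $n\ge 3$, and $\alpha\in\mathbb{R}$. There exist constants $\{a_l\}_{l=0}^{k-1}$ and $\{b_l\}_{l=0}^{k}$, with $a_0=-1$, depending only on $n,k,\alpha$, such that for every smooth positive function $v$ on a domain of $\mathbb{R}^n$, $$\sum_{l=0}^{k-1}a_l\,\big(v^{\alpha+1}|\nabla v|^{2l}S^{ij}_{k-l}v_i\big)_j+\sum_{l=0}^k b_l\,v^\alpha|\nabla v|^{2l}S_{k-l}=0 ,$$ where $S_m=S_m(v)$ and $S^{ij}_m=S^{ij}_m(v)$.
   Context: For $\lambda\in\mathbb{R}^n$, $\sigma_m(\lambda)=\sum_{1\le i_1<\cdots<i_m\le n}\lambda_{i_1}\cdots\lambda_{i_m}$, $\sigma_0=1$. For a positive function $v$, $A_{ij}(v)=v\,v_{ij}-\frac12|\nabla v|^2\delta_{ij}$, $S_m(v)=\sigma_m$ of the eigenvalues of the matrix $(A_{ij}(v))$ (so $S_0=1$), and $S_m^{ij}(v)=\partial S_m/\partial A_{ij}$ evaluated at $A=A(v)$. Subscripts $i,j$ on functions denote partial derivatives, $(\cdot)_j=\partial_j(\cdot)$, and repeated indices $i,j$ are summed from $1$ to $n$. *)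

theory Defs
  imports "HOL-Analysis.Analysis"
    "HOL-Computational_Algebra.Polynomial"
    "HOL-Computational_Algebra.Fundamental_Theorem_Algebra"
begin

text \<open>Elementary symmetric function \<open>\<sigma>\<^sub>m(\<lambda>)\<close>: the strictly increasing index tuples
  \<open>i\<^sub>1 < \<dots> < i\<^sub>m\<close> are the index sets of cardinality \<open>m\<close>.\<close>

definition sigma :: "nat \<Rightarrow> 'a::comm_ring_1 ^ 'n \<Rightarrow> 'a" where
  "sigma m l = (\<Sum>I\<in>{I. card I = m}. \<Prod>i\<in>I. l $ i)"

definition charpoly :: "'a::comm_ring_1 ^ 'n ^ 'n \<Rightarrow> 'a poly" where
  "charpoly A = det (mat [:0, 1:] - (\<chi> i j. [:A $ i $ j:]))"

text \<open>The eigenvalues with algebraic multiplicity, in an unspecified order;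
  they are the complex ones, as real matrices need not have real eigenvalues.\<close>

definition eigenvalues :: "complex ^ 'n ^ 'n \<Rightarrow> complex ^ 'n" where
  "eigenvalues A = (SOME l. charpoly A = (\<Prod>i\<in>UNIV. [:- l $ i, 1:]))"

text \<open>\<open>\<sigma>\<^sub>m\<close> of the eigenvalues of a real matrix. It is defined on all real matrices, not only the
  symmetric ones, because the derivative in a single entry leaves the symmetric matrices.
  The non-real eigenvalues come in conjugate pairs, so \<open>Re\<close> only changes the type.\<close>

definition sigma_mat :: "nat \<Rightarrow> real ^ 'n ^ 'n \<Rightarrow> real" where
  "sigma_mat m A = Re (sigma m (eigenvalues (\<chi> i j. complex_of_real (A $ i $ j))))"

definition dir_deriv :: "('a::real_vector \<Rightarrow> real) \<Rightarrow> 'a \<Rightarrow> 'a \<Rightarrow> real" where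
  "dir_deriv f e x = deriv (\<lambda>t. f (x + t *\<^sub>R e)) 0"

text \<open>\<open>axis i (axis j 1)\<close> is the matrix unit with its only nonzero entry in row \<open>i\<close>, column \<open>j\<close>;
  the entries of \<open>A\<close> are treated as independent variables.\<close>

definition sigma_mat_deriv :: "nat \<Rightarrow> 'n \<Rightarrow> 'n \<Rightarrow> real ^ 'n ^ 'n \<Rightarrow> real" where
  "sigma_mat_deriv m i j A = dir_deriv (sigma_mat m) (axis i (axis j 1)) A"

definition partial :: "'n \<Rightarrow> (real ^ 'n \<Rightarrow> real) \<Rightarrow> real ^ 'n \<Rightarrow> real" where
  "partial i f x = dir_deriv f (axis i 1) x"

definition grad :: "(real ^ 'n \<Rightarrow> real) \<Rightarrow> real ^ 'n \<Rightarrow> real ^ 'n" where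
  "grad f x = (\<chi> i. partial i f x)"

text \<open>Meaningful for open sets \<open>U\<close> only.\<close>

primrec Ck_on :: "nat \<Rightarrow> (real ^ 'n \<Rightarrow> real) \<Rightarrow> (real ^ 'n) set \<Rightarrow> bool" where
  "Ck_on 0 f U \<longleftrightarrow> continuous_on U f"
| "Ck_on (Suc k) f U \<longleftrightarrow> (\<forall>x\<in>U. f differentiable (at x)) \<and> (\<forall>i. Ck_on k (partial i f) U)"

definition smooth_on :: "(real ^ 'n \<Rightarrow> real) \<Rightarrow> (real ^ 'n) set \<Rightarrow> bool" where
  "smooth_on f U \<longleftrightarrow> (\<forall>k. Ck_on k f U)"

definition A_mat :: "(real ^ 'n \<Rightarrow> real) \<Rightarrow> real ^ 'n \<Rightarrow> real ^ 'n ^ 'n" where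
  "A_mat v x = (\<chi> i j. v x * partial j (partial i v) x
                        - 1 / 2 * (norm (grad v x))\<^sup>2 * (if i = j then 1 else 0))"

definition S :: "nat \<Rightarrow> (real ^ 'n \<Rightarrow> real) \<Rightarrow> real ^ 'n \<Rightarrow> real" where
  "S m v x = sigma_mat m (A_mat v x)"

definition S_deriv :: "nat \<Rightarrow> 'n \<Rightarrow> 'n \<Rightarrow> (real ^ 'n \<Rightarrow> real) \<Rightarrow> real ^ 'n \<Rightarrow> real" where
  "S_deriv m i j v x = sigma_mat_deriv m i j (A_mat v x)"

text \<open>Every complex matrix has eigenvalues in the above sense.\<close>

lemma charpoly_monic:
  fixes A :: "'a::idom ^ 'n ^ 'n"
  shows "degree (charpoly A) = CARD('n) \<and> lead_coeff (charpoly A) = 1"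
proof -
  let ?M = "mat [:0, 1:] - (\<chi> i j. [:A $ i $ j:]) :: 'a poly ^ 'n ^ 'n"
  let ?t = "\<lambda>p. of_int (sign p) * (\<Prod>i\<in>UNIV. ?M $ i $ p i)"
  let ?P = "{p. p permutes (UNIV :: 'n set)}"
  have ent: "?M $ i $ j = (if i = j then [:- A $ i $ j, 1:] else [:- A $ i $ j:])" for i j
    by (simp add: mat_def)
  have low: "degree (?t p) < CARD('n)" if p: "p \<in> ?P" "p \<noteq> id" for p
  proof -
    obtain i0 where i0: "p i0 \<noteq> i0" using p(2) by (auto simp: fun_eq_iff)
    have "degree (?t p) \<le> degree (\<Prod>i\<in>UNIV. ?M $ i $ p i)"
      by (cases rule: sign_cases[of p]) auto
    also have "\<dots> \<le> (\<Sum>i\<in>UNIV. degree (?M $ i $ p i))"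
      using degree_prod_sum_le[OF finite, of "\<lambda>i. ?M $ i $ p i" UNIV] by (simp add: o_def)
    also have "\<dots> < (\<Sum>i\<in>(UNIV::'n set). 1)"
    proof (rule sum_strict_mono_ex1)
      show "\<forall>i\<in>UNIV. degree (?M $ i $ p i) \<le> 1" by (simp only: ent) simp
      have "degree (?M $ i0 $ p i0) < 1" using i0 by (simp only: ent) simp
      then show "\<exists>i\<in>UNIV. degree (?M $ i $ p i) < 1" by blast
    qed simp
    finally show ?thesis by simp
  qed
  have diag: "?t id = (\<Prod>i\<in>UNIV. [:- A $ i $ i, 1:])" by (simp only: ent) (simp add: sign_id)
  have ddeg: "degree (?t id) = CARD('n)"
    unfolding diag by (subst degree_prod_eq_sum_degree) auto
  have dlead: "lead_coeff (?t id) = 1"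
    unfolding diag by (subst lead_coeff_prod) simp
  define r where "r = (\<Sum>p\<in>?P - {id}. ?t p)"
  define q where "q = ?t id"
  have "charpoly A = ?t id + r"
    unfolding charpoly_def det_def r_def
    by (rule sum.remove) (simp_all add: permutes_id)
  then have sum: "charpoly A = q + r" unfolding q_def .
  have q: "degree q = CARD('n)" "lead_coeff q = 1"
    using ddeg dlead unfolding q_def by blast+
  have r: "degree r < degree q"
    unfolding q(1) r_def by (rule degree_sum_less) (blast intro: low, simp)
  show ?thesis
    unfolding sum using q degree_add_eq_left[OF r] lead_coeff_add_le[OF r]
    by (simp add: add.commute[of r q])
qed

lemma charpoly_eigenvalues:
  "charpoly A = (\<Prod>i\<in>UNIV. [:- eigenvalues A $ i, 1:])"
  for A :: "complex ^ 'n ^ 'n"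
proof -
  let ?p = "charpoly A"
  have p: "degree ?p = CARD('n)" "lead_coeff ?p = 1" using charpoly_monic[of A] by auto
  then have "?p \<noteq> 0" by auto
  obtain M where M: "size M = degree ?p" "?p = smult (lead_coeff ?p) (\<Prod>x\<in>#M. [:- x, 1:])"
    using alg_closed_imp_factorization[OF \<open>?p \<noteq> 0\<close>] by blast
  obtain xs where xs: "mset xs = M" using ex_mset by blast
  obtain h :: "'n \<Rightarrow> nat" where h: "bij_betw h UNIV {..<length xs}"
    using finite_same_card_bij[of "UNIV :: 'n set" "{..<length xs}"] M(1) p(1) xs
    by (metis card_lessThan finite finite_lessThan size_mset)
  have "?p = (\<Prod>x\<leftarrow>xs. [:- x, 1:])"
    using M(2) p(2) by (simp flip: xs prod_mset_prod_list add: mset_map)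
  also have "\<dots> = (\<Prod>k<length xs. [:- (xs ! k), 1:])"
    by (simp add: prod.list_conv_set_nth atLeast0LessThan)
  also have "\<dots> = (\<Prod>i\<in>UNIV. [:- (\<chi> i. xs ! h i) $ i, 1:])"
    using prod.reindex_bij_betw[OF h, of "\<lambda>k. [:- (xs ! k), 1:]"] by simp
  finally show ?thesis
    unfolding eigenvalues_def by (rule someI)
qed

end

theory Submission
  imports Defs
begin

text \<open>
  Write \<open>n\<close> for the dimension, \<open>g = \<nabla>v\<close>, \<open>p = |g|\<^sup>2\<close>, \<open>A = A(v)\<close> and \<open>\<sigma>\<^sub>m = \<sigma>\<^sub>m(A)\<close>. The derivative of \<open>\<sigma>\<^sub>m\<^sub>+\<^sub>1\<close>
  in the entries of a matrix is the (transposed) Newton tensor \<open>T\<^sub>m\<close>, given by \<open>T\<^sub>0 = I\<close> and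
  \<open>T\<^sub>m\<^sub>+\<^sub>1 = \<sigma>\<^sub>m\<^sub>+\<^sub>1 I - A T\<^sub>m\<close>. Everything rests on three facts about these tensors.

  \<^item> Algebra: \<open>T\<^sub>m\<close> commutes with \<open>A\<close>, \<open>tr T\<^sub>m = (n - m) \<sigma>\<^sub>m\<close> and \<open>tr (A T\<^sub>m) = (m + 1) \<sigma>\<^sub>m\<^sub>+\<^sub>1\<close>. The
    trace formulas are read off from the adjugate of the characteristic matrix, whose coefficients
    are the \<open>T\<^sub>m\<close> up to sign (\<open>newton_tensor_eq_coeff_adjugate\<close>).

  \<^item> Symmetry: \<open>A(v)\<close> fails the Codazzi equation \<open>\<partial>\<^sub>l A\<^sub>i\<^sub>j = \<partial>\<^sub>j A\<^sub>i\<^sub>l\<close> only by terms without third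
    derivatives of \<open>v\<close>, and these terms are bilinear in \<open>A\<close> and \<open>g\<close> because the multiples of the
    identity cancel (\<open>codazzi_defect\<close>).

  \<^item> Divergence: induction along the recursion of \<open>T\<^sub>m\<close> then gives
    \<open>v div T\<^sub>m = n T\<^sub>m g - (n - m) \<sigma>\<^sub>m g\<close> (\<open>divergence_newton_tensor\<close>).

  With \<open>Q\<^sub>m = \<langle>g, T\<^sub>m g\<rangle>\<close> the product rule and the identity \<open>v D\<^sup>2v = A + (p/2) I\<close> yield
  (\<open>divergence_weighted\<close>) that \<open>div (v\<^bsup>\<alpha>+1\<^esup> p\<^bsup>l\<^esup> T\<^sub>m g)\<close> is \<open>v\<^bsup>\<alpha>\<^esup>\<close> times
  \<open>(\<alpha> + 1 + n + l) p\<^bsup>l\<^esup> Q\<^sub>m - 2 l p\<^bsup>l-1\<^esup> Q\<^sub>m\<^sub>+\<^sub>1\<close> plus a combination of \<open>p\<^bsup>l\<^esup> \<sigma>\<^sub>m\<^sub>+\<^sub>1\<close> and \<open>p\<^bsup>l+1\<^esup> \<sigma>\<^sub>m\<close>.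
  For \<open>m = k - l - 1\<close> the quadratic forms that occur are \<open>F\<^sub>l = p\<^bsup>l\<^esup> Q\<^bsub>k-l-1\<^esub>\<close> and \<open>F\<^bsub>l-1\<^esub>\<close>, so the recursion
  \<open>2 (l + 1) a\<^sub>l\<^sub>+\<^sub>1 = (\<alpha> + 1 + n + l) a\<^sub>l\<close> makes them telescope. Only a multiple of
  \<open>F\<^bsub>k-1\<^esub> = p\<^bsup>k-1\<^esup> \<langle>g, g\<rangle> = p\<^bsup>k\<^esup> \<sigma>\<^sub>0\<close> survives, and it has the form of the terms that the coefficients
  \<open>b\<^sub>l\<close> absorb.
\<close>

section \<open>Symmetric functions of eigenvalues as coefficients\<close>

text \<open>Vieta's formula: a choice of one summand in each factor \<open>-l\<^sub>i + X\<close> is the set of indices that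
  contribute their constant term.\<close>

lemma sigma_eq_coeff_prod:
  fixes l :: "'a::comm_ring_1 ^ 'n"
  assumes "m \<le> CARD('n)"
  shows "sigma m l = (- 1) ^ m * coeff (\<Prod>i\<in>UNIV. [:- l $ i, 1:]) (CARD('n) - m)"
proof -
  have X: "prod (\<lambda>i. [:- l $ i:]) I * prod (\<lambda>i. [:0, 1:]) (UNIV - I)
      = smult ((- 1) ^ card I * (\<Prod>i\<in>I. l $ i)) (monom 1 (CARD('n) - card I))" for I :: "'n set"
  proof -
    have "prod (\<lambda>i. [:- l $ i:]) I = [:(- 1) ^ card I * (\<Prod>i\<in>I. l $ i):]"
      by (induction I rule: infinite_finite_induct) (auto simp: algebra_simps one_pCons)
    moreover have "prod (\<lambda>i. [:0, 1::'a:]) (UNIV - I) = monom 1 (CARD('n) - card I)"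
      by (simp add: card_Diff_subset monom_altdef)
    ultimately show ?thesis by simp
  qed
  have "(\<Prod>i\<in>UNIV. [:- l $ i, 1:]) = (\<Prod>i\<in>UNIV. [:- l $ i:] + [:0, 1:])" by simp
  also have "\<dots> = (\<Sum>I\<in>Pow UNIV. prod (\<lambda>i. [:- l $ i:]) I * prod (\<lambda>i. [:0, 1:]) (UNIV - I))"
    by (rule prod_add) simp
  finally have "coeff (\<Prod>i\<in>UNIV. [:- l $ i, 1:]) (CARD('n) - m)
      = (\<Sum>I\<in>UNIV. (- 1) ^ card I * (\<Prod>i\<in>I. l $ i) * (if CARD('n) - card I = CARD('n) - m then 1 else 0))"
    unfolding X by (simp add: coeff_sum)
  also have "\<dots> = (\<Sum>I\<in>UNIV. if card I = m then (- 1) ^ m * (\<Prod>i\<in>I. l $ i) else 0)"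
  proof (rule sum.cong[OF refl])
    fix I :: "'n set"
    have "card I \<le> CARD('n)" by (rule card_mono) auto
    then have "CARD('n) - card I = CARD('n) - m \<longleftrightarrow> card I = m" using assms by linarith
    then show "(- 1) ^ card I * (\<Prod>i\<in>I. l $ i) * (if CARD('n) - card I = CARD('n) - m then 1 else 0)
      = (if card I = m then (- 1) ^ m * (\<Prod>i\<in>I. l $ i) else 0)" by auto
  qed
  also have "\<dots> = (- 1) ^ m * sigma m l"
    unfolding sigma_def by (simp add: sum_distrib_left flip: sum.inter_filter)
  finally show ?thesis by (simp flip: mult.assoc power_mult_distrib)
qed

lemma map_poly_of_real_add:
  "map_poly of_real (p + q) = map_poly of_real p + (map_poly of_real q :: complex poly)"
  by (intro poly_eqI) (simp add: coeff_map_poly)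

lemma map_poly_of_real_mult:
  "map_poly of_real (p * q) = map_poly of_real p * (map_poly of_real q :: complex poly)"
  by (intro poly_eqI) (simp add: coeff_map_poly coeff_mult)

lemma map_poly_of_real_sum:
  "map_poly of_real (\<Sum>x\<in>X. f x) = (\<Sum>x\<in>X. map_poly of_real (f x) :: complex poly)"
  by (induction X rule: infinite_finite_induct) (simp_all add: map_poly_of_real_add)

lemma map_poly_of_real_prod:
  "map_poly of_real (\<Prod>x\<in>X. f x) = (\<Prod>x\<in>X. map_poly of_real (f x) :: complex poly)"
  by (induction X rule: infinite_finite_induct) (simp_all add: map_poly_of_real_mult)

lemma map_poly_of_real_charpoly:
  "map_poly of_real (charpoly A) = charpoly (\<chi> i j. complex_of_real (A $ i $ j))"
proof -
  have sgn: "map_poly of_real (of_int s) = (of_int s :: complex poly)" for s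
    by (intro poly_eqI) (simp add: coeff_map_poly of_int_poly coeff_pCons split: nat.split)
  have ent: "map_poly of_real ((mat [:0, 1:] - (\<chi> i j. [:A $ i $ j:])) $ i $ j)
    = (mat [:0, 1:] - (\<chi> i j. [:complex_of_real (A $ i $ j):])) $ i $ j" for i j
    by (intro poly_eqI) (simp add: coeff_map_poly mat_def coeff_pCons split: nat.split)
  show ?thesis
    unfolding charpoly_def det_def map_poly_of_real_sum map_poly_of_real_mult
      map_poly_of_real_prod sgn ent by simp
qed

text \<open>This replaces the eigenvalues, an arbitrary choice of complex numbers, by the coefficients of the
  real characteristic polynomial, which depend polynomially on the entries.\<close>

lemma sigma_mat_eq_coeff:
  fixes A :: "real ^ 'n ^ 'n"
  assumes "m \<le> CARD('n)"
  shows "sigma_mat m A = (- 1) ^ m * coeff (charpoly A) (CARD('n) - m)"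
proof -
  have "sigma m (eigenvalues (\<chi> i j. complex_of_real (A $ i $ j)))
      = of_real ((- 1) ^ m * coeff (charpoly A) (CARD('n) - m))"
    by (simp add: sigma_eq_coeff_prod[OF assms] coeff_map_poly
        flip: charpoly_eigenvalues map_poly_of_real_charpoly)
  then show ?thesis unfolding sigma_mat_def by (metis Re_complex_of_real)
qed

section \<open>The adjugate of the characteristic matrix\<close>

abbreviation charmat :: "'a::comm_ring_1 ^ 'n ^ 'n \<Rightarrow> 'a poly ^ 'n ^ 'n" where
  "charmat A \<equiv> mat [:0, 1:] - (\<chi> i j. [:A $ i $ j:])"

text \<open>The cofactors are given as determinants in which a row, rather than a row and a column, is
  replaced; no signs and no smaller matrices are needed.\<close>

definition adjugate :: "'a::comm_ring_1 ^ 'n ^ 'n \<Rightarrow> 'a ^ 'n ^ 'n" where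
  "adjugate M = (\<chi> i j. det (\<chi> k. if k = j then axis i 1 else M $ k))"

lemma det_replace_row_expansion:
  fixes M :: "'a::comm_ring_1 ^ 'n ^ 'n"
  shows "det (\<chi> k. if k = j then w else M $ k) = (\<Sum>i\<in>UNIV. w $ i * adjugate M $ i $ j)"
proof -
  have "w = (\<Sum>i\<in>UNIV. w $ i *s axis i 1)"
    by (simp add: vec_eq_iff axis_def if_distrib cong: if_cong)
  then have "det (\<chi> k. if k = j then w else M $ k)
    = det (\<chi> k. if k = j then (\<Sum>i\<in>UNIV. w $ i *s axis i 1) else M $ k)" by (rule arg_cong)
  also have "\<dots> = (\<Sum>i\<in>UNIV. det (\<chi> k. if k = j then w $ i *s axis i 1 else M $ k))"
    by (rule det_linear_row_sum) simp
  finally show ?thesis by (simp add: det_row_mul adjugate_def)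
qed

lemma mult_adjugate: "M ** adjugate M = mat (det M)"
  for M :: "'a::comm_ring_1 ^ 'n ^ 'n"
proof -
  have "(\<Sum>i\<in>UNIV. M $ k $ i * adjugate M $ i $ j) = (if k = j then det M else 0)" for k j
  proof (cases "k = j")
    case True
    then have "(\<chi> i. if i = j then M $ k else M $ i) = M" by (simp add: vec_eq_iff)
    then show ?thesis unfolding det_replace_row_expansion[symmetric] using True by simp
  next
    case False
    have "det (\<chi> i. if i = j then M $ k else M $ i) = 0"
      by (rule det_identical_rows[OF False]) (use False in \<open>simp add: row_def vec_eq_iff\<close>)
    then show ?thesis using False by (simp flip: det_replace_row_expansion)
  qed
  then show ?thesis by (simp add: vec_eq_iff matrix_matrix_mult_def mat_def)
qed

text \<open>The determinant is affine in every single entry, and its slope is a cofactor. So the partial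
  derivatives of all coefficients of the characteristic polynomial come without any analysis.\<close>

lemma det_add_axis:
  fixes M :: "'a::comm_ring_1 ^ 'n ^ 'n"
  shows "det (M + axis i (axis j c)) = det M + c * adjugate M $ j $ i"
proof -
  have "M + axis i (axis j c) = (\<chi> k. if k = i then M $ i + axis j c else M $ k)"
    by (simp add: vec_eq_iff axis_def)
  then have "det (M + axis i (axis j c)) = det (\<chi> k. if k = i then M $ i else M $ k)
      + det (\<chi> k. if k = i then axis j c else M $ k)" by (simp add: det_row_add)
  also have "(\<chi> k. if k = i then M $ i else M $ k) = M" by (simp add: vec_eq_iff)
  also have "det (\<chi> k. if k = i then axis j c else M $ k) = c * adjugate M $ j $ i"
    by (simp add: det_replace_row_expansion axis_def if_distrib[of "\<lambda>x. x * _"] cong: if_cong)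
  finally show ?thesis .
qed

lemma pderiv_sum: "pderiv (\<Sum>x\<in>X. f x) = (\<Sum>x\<in>X. pderiv (f x))"
  by (induction X rule: infinite_finite_induct) (simp_all add: pderiv_add)

text \<open>Jacobi's formula for the path \<open>X I - A\<close>, whose derivative is \<open>I\<close>. Differentiating the row \<open>i\<close>
  replaces it by the unit vector \<open>e\<^sub>i\<close>, and this is how the diagonal of the adjugate is defined.\<close>

lemma pderiv_charpoly:
  "pderiv (charpoly A) = trace (adjugate (charmat A))"
  for A :: "'a::idom ^ 'n ^ 'n"
proof -
  let ?M = "charmat A"
  have pd: "pderiv (?M $ i $ j) = (if i = j then 1 else 0)" for i j
    by (simp add: mat_def pderiv_diff pderiv_pCons)
  have *: "(\<Prod>k\<in>UNIV - {i}. ?M $ k $ p k) * pderiv (?M $ i $ p i)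
    = (\<Prod>k\<in>UNIV. (\<chi> k. if k = i then axis i 1 else ?M $ k) $ k $ p k)" for i p
    by (subst prod.remove[of UNIV i], simp, simp, subst pd) (auto simp: axis_def intro!: prod.cong)
  have sgn: "pderiv (of_int s) = (0 :: 'a poly)" for s
    by (simp add: of_int_poly)
  have "pderiv (charpoly A) = (\<Sum>p | p permutes UNIV. of_int (sign p) *
      (\<Sum>i\<in>UNIV. (\<Prod>k\<in>UNIV - {i}. ?M $ k $ p k) * pderiv (?M $ i $ p i)))"
    unfolding charpoly_def det_def
    by (simp only: pderiv_sum pderiv_mult pderiv_prod sgn) simp
  also have "\<dots> = (\<Sum>i\<in>UNIV. \<Sum>p | p permutes UNIV. of_int (sign p) *
     (\<Prod>k\<in>UNIV. (\<chi> k. if k = i then axis i 1 else ?M $ k) $ k $ p k))"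
    by (subst sum.swap) (simp only: * sum_distrib_left)
  finally show ?thesis
    by (simp add: trace_def adjugate_def det_def)
qed

section \<open>Newton tensors\<close>

primrec newton_tensor :: "nat \<Rightarrow> real ^ 'n ^ 'n \<Rightarrow> real ^ 'n ^ 'n" where
  "newton_tensor 0 A = mat 1"
| "newton_tensor (Suc m) A = sigma_mat (Suc m) A *\<^sub>R mat 1 - A ** newton_tensor m A"

lemma sigma_mat_0 [simp]: "sigma_mat 0 A = 1"
  using charpoly_monic[of A] by (auto simp add: sigma_mat_eq_coeff)

text \<open>Comparing coefficients in \<open>(X I - A) adj(X I - A) = charpoly A\<close> gives a recursion that goes down in
  the degree and is the defining recursion of the Newton tensors up to sign. The extra factor \<open>X\<close>
  (the \<open>pCons 0\<close>) makes the formula hold up to \<open>m = n\<close>, where it says \<open>T\<^sub>n = 0\<close>, the theorem of Cayley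
  and Hamilton.\<close>

lemma newton_tensor_eq_coeff_adjugate:
  fixes A :: "real ^ 'n ^ 'n"
  assumes "m \<le> CARD('n)"
  shows "newton_tensor m A
    = (- 1) ^ m *\<^sub>R (\<chi> i j. coeff (pCons 0 (adjugate (charmat A) $ i $ j)) (CARD('n) - m))"
proof -
  define C where "C k = (\<chi> i j. coeff (pCons 0 (adjugate (charmat A) $ i $ j)) k)" for k
  \<comment> \<open>\<open>C k\<close> is the coefficient of \<open>X\<^bsup>k\<^esup>\<close> in \<open>X adj(X I - A)\<close>, hence \<open>C (Suc k)\<close> that of \<open>X\<^bsup>k\<^esup>\<close> in the adjugate.\<close>
  have rec: "C k = coeff (charpoly A) k *\<^sub>R mat 1 + A ** C (Suc k)" for k
  proof -
    have "pCons 0 (adjugate (charmat A) $ i $ j)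
        = (if i = j then charpoly A else 0)
          + (\<Sum>l\<in>UNIV. smult (A $ i $ l) (adjugate (charmat A) $ l $ j))" for i j
    proof -
      have "(if i = j then charpoly A else 0) = (charmat A ** adjugate (charmat A)) $ i $ j"
        unfolding mult_adjugate by (simp add: charpoly_def mat_def)
      also have "\<dots> = (\<Sum>l\<in>UNIV. (if i = l then pCons 0 (adjugate (charmat A) $ l $ j) else 0)
          - smult (A $ i $ l) (adjugate (charmat A) $ l $ j))"
        unfolding matrix_matrix_mult_def by (auto simp: mat_def algebra_simps intro!: sum.cong)
      finally show ?thesis by (simp add: sum_subtractf)
    qed
    then have "coeff (pCons 0 (adjugate (charmat A) $ i $ j)) k
        = (if i = j then coeff (charpoly A) k else 0)
          + (\<Sum>l\<in>UNIV. A $ i $ l * coeff (adjugate (charmat A) $ l $ j) k)" for i j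
      by (simp add: coeff_sum)
    then show ?thesis
      unfolding C_def by (simp add: vec_eq_iff matrix_matrix_mult_def mat_def)
  qed
  \<comment> \<open>The recursion starts at the top: all \<open>C k\<close> of large index vanish, and above degree \<open>n\<close> the
    recursion has no inhomogeneous term, so the zero propagates downwards.\<close>
  have top: "C k = 0" if k: "CARD('n) < k" for k
  proof -
    define N where "N = Max (range (\<lambda>(i, j). degree (pCons 0 (adjugate (charmat A) $ i $ j)))) + k"
    have "degree (pCons 0 (adjugate (charmat A) $ i $ j)) \<le> N" for i j
      unfolding N_def by (rule trans_le_add1, rule Max_ge) (auto intro!: image_eqI[of _ _ "(i, j)"])
    then have "coeff (pCons 0 (adjugate (charmat A) $ i $ j)) (Suc N) = 0" for i j
      by (intro coeff_eq_0 le_imp_less_Suc)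
    then have N: "C (Suc N) = 0" unfolding C_def by (simp only: vec_eq_iff) simp
    have "k \<le> Suc N" by (simp add: N_def)
    from this k show ?thesis
    proof (induction k rule: inc_induct)
      case base
      show ?case by (rule N)
    next
      case (step k)
      moreover have "coeff (charpoly A) k = 0"
        using step.prems charpoly_monic[of A] by (simp add: coeff_eq_0)
      ultimately show ?case by (simp add: rec[of k])
    qed
  qed
  have "newton_tensor m A = (- 1) ^ m *\<^sub>R C (CARD('n) - m)"
    using assms
  proof (induction m)
    case 0
    then show ?case using charpoly_monic[of A] by (auto simp add: rec[of "CARD('n)"] top)
  next
    case (Suc m)
    then have "Suc (CARD('n) - Suc m) = CARD('n) - m" by simp
    with Suc show ?case
      by (simp add: rec[of "CARD('n) - Suc m"] sigma_mat_eq_coeff matrix_scalar_ac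
          flip: scalar_matrix_assoc) (simp add: scaleR_right_distrib)
  qed
  then show ?thesis unfolding C_def .
qed

text \<open>The trace of the adjugate is the derivative of the characteristic polynomial, so the factor
  \<open>n - m\<close> is the exponent of the monomial that carries \<open>\<sigma>\<^sub>m\<close>.\<close>

lemma trace_newton_tensor:
  fixes A :: "real ^ 'n ^ 'n"
  assumes "m \<le> CARD('n)"
  shows "trace (newton_tensor m A) = (real CARD('n) - real m) * sigma_mat m A"
proof -
  have "trace (newton_tensor m A)
    = (- 1) ^ m * coeff (\<Sum>i\<in>UNIV. pCons 0 (adjugate (charmat A) $ i $ i)) (CARD('n) - m)"
    by (simp add: newton_tensor_eq_coeff_adjugate[OF assms] trace_def coeff_sum sum_distrib_left)
  also have "(\<Sum>i\<in>UNIV. pCons 0 (adjugate (charmat A) $ i $ i)) = pCons 0 (pderiv (charpoly A))"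
    unfolding pderiv_charpoly trace_def
    by (intro poly_eqI) (simp add: coeff_sum coeff_pCons split: nat.split)
  also have "coeff (pCons 0 (pderiv (charpoly A))) (CARD('n) - m)
      = (real CARD('n) - real m) * coeff (charpoly A) (CARD('n) - m)"
    using assms by (cases "CARD('n) - m") (auto simp: coeff_pderiv of_nat_diff
      simp flip: of_nat_Suc)
  finally show ?thesis by (simp add: sigma_mat_eq_coeff[OF assms])
qed

text \<open>Taking traces in the recursion for \<open>T\<^sub>m\<^sub>+\<^sub>1\<close>. As \<open>T\<^sub>m\<close> contains only \<open>\<sigma>\<^sub>1, \<dots>, \<sigma>\<^sub>m\<close>, this also expresses
  \<open>\<sigma>\<^sub>m\<^sub>+\<^sub>1\<close> through earlier ones.\<close>

lemma newton_identity:
  fixes A :: "real ^ 'n ^ 'n"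
  assumes "Suc m \<le> CARD('n)"
  shows "trace (A ** newton_tensor m A) = real (Suc m) * sigma_mat (Suc m) A"
proof -
  have "trace (newton_tensor (Suc m) A)
      = real CARD('n) * sigma_mat (Suc m) A - trace (A ** newton_tensor m A)"
    by (simp add: trace_sub) (simp add: trace_def mat_def)
  then show ?thesis using trace_newton_tensor[OF assms, of A] by (simp add: algebra_simps)
qed

text \<open>The index reversal \<open>(j, i)\<close> against \<open>(i, j)\<close> is the transposition in the adjugate.\<close>

lemma sigma_mat_add_matrix_unit:
  fixes A :: "real ^ 'n ^ 'n"
  assumes "Suc m \<le> CARD('n)"
  shows "sigma_mat (Suc m) (A + t *\<^sub>R axis i (axis j 1))
    = sigma_mat (Suc m) A + t * newton_tensor m A $ j $ i"
proof -
  have "charmat (A + t *\<^sub>R axis i (axis j 1)) = charmat A + axis i (axis j [:- t:])"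
    by (simp add: vec_eq_iff axis_def)
  then have "charpoly (A + t *\<^sub>R axis i (axis j 1))
      = charpoly A - smult t (adjugate (charmat A) $ j $ i)"
    unfolding charpoly_def by (simp only: det_add_axis) simp
  moreover have "CARD('n) - m = Suc (CARD('n) - Suc m)" using assms by simp
  moreover have "m \<le> CARD('n)" using assms by simp
  ultimately show ?thesis
    by (simp add: sigma_mat_eq_coeff[OF assms] newton_tensor_eq_coeff_adjugate
        right_diff_distrib mult.left_commute)
qed

lemma sigma_mat_deriv_eq_newton_tensor:
  fixes A :: "real ^ 'n ^ 'n"
  assumes "Suc m \<le> CARD('n)"
  shows "sigma_mat_deriv (Suc m) i j A = newton_tensor m A $ j $ i"
  unfolding sigma_mat_deriv_def dir_deriv_def sigma_mat_add_matrix_unit[OF assms]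
  by (rule DERIV_imp_deriv) (auto intro!: derivative_eq_intros)

lemma matrix_diff_ldistrib: "A ** (B - C) = A ** B - A ** C"
  for A :: "'a::comm_ring_1 ^ 'n ^ 'm"
  by (simp add: vec_eq_iff matrix_matrix_mult_def right_diff_distrib sum_subtractf)

lemma matrix_diff_rdistrib: "(A - B) ** C = A ** C - B ** C"
  for C :: "'a::comm_ring_1 ^ 'n ^ 'm"
  by (simp add: vec_eq_iff matrix_matrix_mult_def left_diff_distrib sum_subtractf)

lemma newton_tensor_commute: "A ** newton_tensor m A = newton_tensor m A ** A"
proof (induction m)
  case (Suc m)
  then show ?case
    by (simp add: matrix_diff_ldistrib matrix_diff_rdistrib matrix_scalar_ac matrix_mul_assoc
        flip: scalar_matrix_assoc)
qed simp

lemma transpose_newton_tensor: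
  assumes "transpose A = A"
  shows "transpose (newton_tensor m A) = newton_tensor m A"
proof (induction m)
  case (Suc m)
  have d: "transpose (B - C) = transpose B - transpose C" for B C :: "real^'n^'n"
    by (simp add: transpose_def vec_eq_iff)
  show ?case
    by (simp add: d transpose_scalar matrix_transpose_mul Suc assms newton_tensor_commute)
qed simp

section \<open>Differentiating along paths of matrices\<close>

lemma matrix_eq_sum_axis: "A = (\<Sum>i\<in>UNIV. \<Sum>j\<in>UNIV. A $ i $ j *\<^sub>R axis i (axis j 1))"
  for A :: "real ^ 'n ^ 'm"
proof -
  have "(\<Sum>j\<in>UNIV. A $ i $ j * axis i (axis j 1) $ k $ l) = (if i = k then A $ i $ l else 0)"
    for i k l
    by (cases "i = k") (auto simp: axis_def if_distrib cong: if_cong)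
  then show ?thesis by (simp add: vec_eq_iff)
qed

lemma differentiable_matrix_entry: "(\<lambda>A::real ^ 'n ^ 'm. A $ i $ j) differentiable (at A)"
  by (intro bounded_linear_imp_differentiable
      bounded_linear_compose[OF bounded_linear_vec_nth bounded_linear_vec_nth])

text \<open>Newton's identity and the recursion build \<open>\<sigma>\<^sub>m\<close> and \<open>T\<^sub>m\<close> alternately from the entries by sums and
  products. The total derivative is wanted, since a path \<open>t \<mapsto> A(v)(x + t e\<^sub>l)\<close> moves all the entries
  at once.\<close>

lemma differentiable_sigma_mat_newton_tensor:
  fixes A :: "real ^ 'n ^ 'n"
  assumes "m \<le> CARD('n)"
  shows "sigma_mat m differentiable (at A)"
    and "(\<lambda>A :: real ^ 'n ^ 'n. newton_tensor m A $ i $ j) differentiable (at A)"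
proof -
  have "sigma_mat m differentiable (at A)
    \<and> (\<forall>i j. (\<lambda>A :: real ^ 'n ^ 'n. newton_tensor m A $ i $ j) differentiable (at A))"
    using assms
  proof (induction m)
    case 0
    have "sigma_mat 0 = (\<lambda>A :: real ^ 'n ^ 'n. 1)" by (simp add: fun_eq_iff)
    then show ?case by simp
  next
    case (Suc m)
    have T: "(\<lambda>A :: real ^ 'n ^ 'n. newton_tensor m A $ i $ j) differentiable (at A)" for i j
      using Suc by simp
    have P: "(\<lambda>A :: real ^ 'n ^ 'n. (A ** newton_tensor m A) $ i $ j) differentiable (at A)" for i j
      unfolding matrix_matrix_mult_def
      by (simp, intro differentiable_sum differentiable_mult differentiable_matrix_entry T ballI) simp
    have "sigma_mat (Suc m)
        = (\<lambda>A :: real ^ 'n ^ 'n. inverse (real (Suc m)) * trace (A ** newton_tensor m A))"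
      by (rule ext, subst newton_identity[OF Suc.prems]) (simp del: of_nat_Suc)
    moreover have "(\<lambda>A :: real ^ 'n ^ 'n. inverse (real (Suc m)) * trace (A ** newton_tensor m A))
        differentiable (at A)"
      unfolding trace_def
      by (intro differentiable_mult differentiable_const differentiable_sum P ballI) simp
    ultimately have S: "sigma_mat (Suc m) differentiable (at A)" by simp
    have "(\<lambda>A :: real ^ 'n ^ 'n. newton_tensor (Suc m) A $ i $ j) differentiable (at A)" for i j
      by (simp, intro differentiable_diff differentiable_mult S P differentiable_const)
    with S show ?case by blast
  qed
  then show "sigma_mat m differentiable (at A)"
    "(\<lambda>A :: real ^ 'n ^ 'n. newton_tensor m A $ i $ j) differentiable (at A)"
    by auto
qed

text \<open>Differentiability being known, the derivative is determined by its values on the matrix units,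
  where \<open>\<sigma>\<^sub>m\<^sub>+\<^sub>1\<close> is affine.\<close>

lemma has_derivative_sigma_mat:
  fixes A :: "real ^ 'n ^ 'n"
  assumes "Suc m \<le> CARD('n)"
  shows "(sigma_mat (Suc m) has_derivative
    (\<lambda>H. \<Sum>i\<in>UNIV. \<Sum>j\<in>UNIV. newton_tensor m A $ j $ i * H $ i $ j)) (at A)"
proof -
  obtain D where D: "(sigma_mat (Suc m) has_derivative D) (at A)"
    using differentiable_sigma_mat_newton_tensor(1)[OF assms] unfolding differentiable_def by blast
  interpret D: linear D using has_derivative_linear[OF D] .
  have unit: "D (axis i (axis j 1)) = newton_tensor m A $ j $ i" for i j
  proof -
    let ?E = "axis i (axis j 1) :: real ^ 'n ^ 'n"
    have "((\<lambda>t::real. A + t *\<^sub>R ?E) has_derivative (\<lambda>t. t *\<^sub>R ?E)) (at 0)"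
      by (auto intro!: derivative_eq_intros)
    moreover have "(sigma_mat (Suc m) has_derivative D) (at (A + 0 *\<^sub>R ?E))"
      using D by simp
    ultimately have "((\<lambda>t::real. sigma_mat (Suc m) (A + t *\<^sub>R ?E)) has_derivative (\<lambda>t. D (t *\<^sub>R ?E))) (at 0)"
      by (rule has_derivative_compose)
    then have "((\<lambda>t. sigma_mat (Suc m) (A + t *\<^sub>R ?E)) has_real_derivative D ?E) (at 0)"
      by (simp add: D.scale has_field_derivative_def mult_commute_abs)
    moreover have "((\<lambda>t. sigma_mat (Suc m) (A + t *\<^sub>R ?E))
        has_real_derivative newton_tensor m A $ j $ i) (at 0)"
      unfolding sigma_mat_add_matrix_unit[OF assms] by (auto intro!: derivative_eq_intros)
    ultimately show ?thesis by (rule DERIV_unique)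
  qed
  have "D H = (\<Sum>i\<in>UNIV. \<Sum>j\<in>UNIV. newton_tensor m A $ j $ i * H $ i $ j)" for H
    by (subst matrix_eq_sum_axis[of H]) (simp add: D.sum D.scale unit mult.commute)
  then have "D = (\<lambda>H. \<Sum>i\<in>UNIV. \<Sum>j\<in>UNIV. newton_tensor m A $ j $ i * H $ i $ j)" by (rule ext)
  with D show ?thesis by (rule back_subst[of "\<lambda>D. (_ has_derivative D) _"])
qed

lemma matrix_path_has_derivative:
  fixes W :: "real \<Rightarrow> real ^ 'n ^ 'm"
  assumes "\<And>i j. ((\<lambda>t. W t $ i $ j) has_real_derivative W' $ i $ j) (at t)"
  shows "(W has_derivative (\<lambda>h. h *\<^sub>R W')) (at t)"
proof -
  have "((\<lambda>t. \<Sum>i\<in>UNIV. \<Sum>j\<in>UNIV. W t $ i $ j *\<^sub>R axis i (axis j 1)) has_derivative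
     (\<lambda>h. \<Sum>i\<in>UNIV. \<Sum>j\<in>UNIV. (h * W' $ i $ j) *\<^sub>R axis i (axis j 1 :: real ^ 'n))) (at t)"
    using assms
    by (intro has_derivative_sum has_derivative_scaleR_left)
       (simp add: has_field_derivative_def mult_commute_abs)
  moreover have "(\<Sum>i\<in>UNIV. \<Sum>j\<in>UNIV. (h * W' $ i $ j) *\<^sub>R axis i (axis j 1)) = h *\<^sub>R W'" for h
    using matrix_eq_sum_axis[of "h *\<^sub>R W'"] by simp
  ultimately show ?thesis unfolding matrix_eq_sum_axis[symmetric] by simp
qed

lemma sigma_mat_path_derivative:
  fixes W :: "real \<Rightarrow> real ^ 'n ^ 'n"
  assumes "Suc m \<le> CARD('n)"
    and "\<And>i j. ((\<lambda>t. W t $ i $ j) has_real_derivative W' $ i $ j) (at t)"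
  shows "((\<lambda>t. sigma_mat (Suc m) (W t)) has_real_derivative
    (\<Sum>i\<in>UNIV. \<Sum>j\<in>UNIV. newton_tensor m (W t) $ j $ i * W' $ i $ j)) (at t)"
proof -
  have "((\<lambda>t. sigma_mat (Suc m) (W t)) has_derivative
    (\<lambda>h. \<Sum>i\<in>UNIV. \<Sum>j\<in>UNIV. newton_tensor m (W t) $ j $ i * (h *\<^sub>R W') $ i $ j)) (at t)"
    by (rule has_derivative_compose[OF matrix_path_has_derivative[OF assms(2)]
        has_derivative_sigma_mat[OF assms(1)]])
  then show ?thesis
    unfolding has_field_derivative_def
    by (rule has_derivative_eq_rhs) (simp add: fun_eq_iff sum_distrib_left sum_distrib_right mult_ac)
qed

lemma newton_tensor_path_differentiable:
  fixes W :: "real \<Rightarrow> real ^ 'n ^ 'n"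
  assumes "m \<le> CARD('n)"
    and "\<And>i j. ((\<lambda>t. W t $ i $ j) has_real_derivative W' $ i $ j) (at t)"
  shows "(\<lambda>t. newton_tensor m (W t) $ i $ j) differentiable (at t)"
proof -
  have "(\<lambda>A. newton_tensor m A $ i $ j) \<circ> W differentiable (at t)"
    using matrix_path_has_derivative[OF assms(2)]
    by (intro differentiable_chain_at differentiable_sigma_mat_newton_tensor assms)
       (auto simp: differentiable_def)
  then show ?thesis by (simp add: o_def)
qed

section \<open>Partial derivatives and their symmetry\<close>

lemma partial_eqI:
  "((\<lambda>t. f (x + t *\<^sub>R axis j 1)) has_real_derivative d) (at 0) \<Longrightarrow> partial j f x = d"
  unfolding partial_def dir_deriv_def by (rule DERIV_imp_deriv)

lemma differentiable_has_partial_at: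
  fixes f :: "real ^ 'n \<Rightarrow> real"
  assumes "f differentiable (at (x + s *\<^sub>R axis j 1))"
  shows "((\<lambda>t. f (x + t *\<^sub>R axis j 1)) has_real_derivative partial j f (x + s *\<^sub>R axis j 1)) (at s)"
proof -
  let ?e = "axis j 1 :: real ^ 'n"
  obtain D where D: "(f has_derivative D) (at (x + s *\<^sub>R ?e))"
    using assms unfolding differentiable_def by blast
  interpret D: linear D using has_derivative_linear[OF D] .
  have *: "((\<lambda>t. f (y + t *\<^sub>R ?e)) has_real_derivative D ?e) (at r)"
    if "y + r *\<^sub>R ?e = x + s *\<^sub>R ?e" for y r
  proof -
    have "((\<lambda>t::real. y + t *\<^sub>R ?e) has_derivative (\<lambda>t. t *\<^sub>R ?e)) (at r)"
      by (auto intro!: derivative_eq_intros)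
    then have "((\<lambda>t::real. f (y + t *\<^sub>R ?e)) has_derivative (\<lambda>t. D (t *\<^sub>R ?e))) (at r)"
      by (rule has_derivative_compose) (simp add: that D)
    then show ?thesis by (simp add: D.scale has_field_derivative_def mult_commute_abs)
  qed
  have "partial j f (x + s *\<^sub>R ?e) = D ?e" by (rule partial_eqI[OF *]) simp
  with *[of x s] show ?thesis by simp
qed

lemmas differentiable_has_partial =
  differentiable_has_partial_at[where s = 0, simplified]

text \<open>The mean value theorem applied twice, first to the difference in direction \<open>j\<close> as a function of
  the first step, then to \<open>\<partial>\<^sub>i f\<close>. The left-hand side is symmetric in \<open>i\<close> and \<open>j\<close>.\<close>

lemma double_difference_mean_value:
  fixes f :: "real ^ 'n \<Rightarrow> real"
  assumes h: "0 < h"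
    and inU: "\<And>s t. 0 \<le> s \<Longrightarrow> s \<le> h \<Longrightarrow> 0 \<le> t \<Longrightarrow> t \<le> h \<Longrightarrow> x + s *\<^sub>R axis i 1 + t *\<^sub>R axis j 1 \<in> U"
    and f: "\<And>y. y \<in> U \<Longrightarrow> f differentiable (at y)"
    and fi: "\<And>y. y \<in> U \<Longrightarrow> partial i f differentiable (at y)"
  obtains s t where "0 < s" "s < h" "0 < t" "t < h"
    "f (x + h *\<^sub>R axis i 1 + h *\<^sub>R axis j 1) - f (x + h *\<^sub>R axis i 1) - f (x + h *\<^sub>R axis j 1) + f x
      = h * (h * partial j (partial i f) (x + s *\<^sub>R axis i 1 + t *\<^sub>R axis j 1))"
proof -
  let ?i = "axis i 1 :: real ^ 'n" and ?j = "axis j 1 :: real ^ 'n"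
  have d1: "((\<lambda>s. f (x + h *\<^sub>R ?j + s *\<^sub>R ?i) - f (x + s *\<^sub>R ?i)) has_real_derivative
      partial i f (x + h *\<^sub>R ?j + s *\<^sub>R ?i) - partial i f (x + s *\<^sub>R ?i)) (at s)"
    if "0 \<le> s" "s \<le> h" for s
    using inU[of s h] inU[of s 0] that h
    by (intro DERIV_diff differentiable_has_partial_at f) (simp_all add: add_ac)
  obtain s where s: "0 < s" "s < h" and "f (x + h *\<^sub>R ?j + h *\<^sub>R ?i) - f (x + h *\<^sub>R ?i)
       - (f (x + h *\<^sub>R ?j + 0 *\<^sub>R ?i) - f (x + 0 *\<^sub>R ?i))
      = (h - 0) * (partial i f (x + h *\<^sub>R ?j + s *\<^sub>R ?i) - partial i f (x + s *\<^sub>R ?i))"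
    using MVT2[OF h d1] by blast
  moreover have d2: "((\<lambda>t. partial i f (x + s *\<^sub>R ?i + t *\<^sub>R ?j)) has_real_derivative
      partial j (partial i f) (x + s *\<^sub>R ?i + t *\<^sub>R ?j)) (at t)"
    if "0 \<le> t" "t \<le> h" for t
    using inU[of s t] that s by (intro differentiable_has_partial_at fi) simp
  obtain t where t: "0 < t" "t < h" and
    "partial i f (x + s *\<^sub>R ?i + h *\<^sub>R ?j) - partial i f (x + s *\<^sub>R ?i + 0 *\<^sub>R ?j)
      = (h - 0) * partial j (partial i f) (x + s *\<^sub>R ?i + t *\<^sub>R ?j)"
    using MVT2[OF h d2] by blast
  ultimately show ?thesis
    by (intro that[OF s t]) (simp add: add_ac)
qed

text \<open>Schwarz's theorem: the double difference, divided by \<open>h\<^sup>2\<close>, equals either mixed derivative at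
  some point within distance \<open>2 h\<close> of \<open>x\<close>, and both are continuous.\<close>

lemma partial_commute:
  fixes f :: "real ^ 'n \<Rightarrow> real"
  assumes U: "open U" "x \<in> U" and f: "Ck_on 2 f U"
  shows "partial j (partial i f) x = partial i (partial j f) x"
proof (rule ccontr)
  let ?G = "partial j (partial i f)" and ?H = "partial i (partial j f)"
  assume neq: "?G x \<noteq> ?H x"
  define \<epsilon> where "\<epsilon> = dist (?G x) (?H x) / 2"
  have \<epsilon>: "0 < \<epsilon>" using neq by (simp add: \<epsilon>_def)
  have f: "\<And>y. y \<in> U \<Longrightarrow> f differentiable (at y)"
    "\<And>i y. y \<in> U \<Longrightarrow> partial i f differentiable (at y)"
    "\<And>i j. continuous_on U (partial j (partial i f))"
    using f by (auto simp: numeral_2_eq_2)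
  have "eventually (\<lambda>y. y \<in> U \<and> dist (?G y) (?G x) < \<epsilon> \<and> dist (?H y) (?H x) < \<epsilon>) (nhds x)"
  proof -
    have "isCont ?G x" "isCont ?H x"
      using f(3) U continuous_on_eq_continuous_at by blast+
    then show ?thesis
      using eventually_nhds_in_open[OF U] \<epsilon>
      by (auto simp: isCont_def tendsto_at_iff_tendsto_nhds intro!: eventually_conj tendstoD)
  qed
  then obtain d where d: "d > 0" "\<And>y. dist y x < d \<Longrightarrow> y \<in> U"
    "\<And>y. dist y x < d \<Longrightarrow> dist (?G y) (?G x) < \<epsilon>"
    "\<And>y. dist y x < d \<Longrightarrow> dist (?H y) (?H x) < \<epsilon>"
    unfolding eventually_nhds_metric by blast
  \<comment> \<open>Two steps of length at most \<open>d / 3\<close> do not leave the ball of radius \<open>d\<close>.\<close>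
  define h where "h = d / 3"
  have h: "0 < h" using d by (simp add: h_def)
  have near: "dist (x + s *\<^sub>R axis k 1 + t *\<^sub>R axis l 1) x < d"
    if "0 \<le> s" "s \<le> h" "0 \<le> t" "t \<le> h" for s t k l
  proof -
    have "dist (x + s *\<^sub>R axis k 1 + t *\<^sub>R axis l 1) x
        = norm (s *\<^sub>R axis k 1 + t *\<^sub>R axis l 1 :: real ^ 'n)"
      by (simp add: dist_norm add.assoc)
    also have "\<dots> \<le> norm (s *\<^sub>R axis k 1 :: real ^ 'n) + norm (t *\<^sub>R axis l 1 :: real ^ 'n)"
      by (rule norm_triangle_ineq)
    also have "\<dots> < d" using that d(1) by (simp add: h_def norm_axis_1)
    finally show ?thesis .
  qed
  obtain s t where 1: "0 < s" "s < h" "0 < t" "t < h"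
    "f (x + h *\<^sub>R axis i 1 + h *\<^sub>R axis j 1) - f (x + h *\<^sub>R axis i 1) - f (x + h *\<^sub>R axis j 1) + f x
      = h * (h * ?G (x + s *\<^sub>R axis i 1 + t *\<^sub>R axis j 1))"
    by (rule double_difference_mean_value[OF h d(2)[OF near] f(1) f(2)])
  obtain s' t' where 2: "0 < s'" "s' < h" "0 < t'" "t' < h"
    "f (x + h *\<^sub>R axis j 1 + h *\<^sub>R axis i 1) - f (x + h *\<^sub>R axis j 1) - f (x + h *\<^sub>R axis i 1) + f x
      = h * (h * ?H (x + s' *\<^sub>R axis j 1 + t' *\<^sub>R axis i 1))"
    by (rule double_difference_mean_value[OF h d(2)[OF near] f(1) f(2)])
  have "h * (h * ?G (x + s *\<^sub>R axis i 1 + t *\<^sub>R axis j 1))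
      = h * (h * ?H (x + s' *\<^sub>R axis j 1 + t' *\<^sub>R axis i 1))"
    unfolding 1(5)[symmetric] 2(5)[symmetric] by (simp add: add_ac)
  then have "?G (x + s *\<^sub>R axis i 1 + t *\<^sub>R axis j 1)
      = ?H (x + s' *\<^sub>R axis j 1 + t' *\<^sub>R axis i 1)" using h by simp
  moreover have "dist (?G (x + s *\<^sub>R axis i 1 + t *\<^sub>R axis j 1)) (?G x) < \<epsilon>"
    "dist (?H (x + s' *\<^sub>R axis j 1 + t' *\<^sub>R axis i 1)) (?H x) < \<epsilon>"
    using 1 2 by (auto intro!: d near)
  ultimately have "dist (?G x) (?H x) < dist (?G x) (?H x)"
    unfolding \<epsilon>_def by (metis dist_commute dist_triangle_half_l)
  then show False by simp
qed

lemma smooth_on_differentiable: "smooth_on f U \<Longrightarrow> x \<in> U \<Longrightarrow> f differentiable (at x)"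
  unfolding smooth_on_def by (metis Ck_on.simps(2))

lemma smooth_on_partial: "smooth_on f U \<Longrightarrow> smooth_on (partial i f) U"
  unfolding smooth_on_def by (metis Ck_on.simps(2))

lemma smooth_on_partial_commute:
  "open U \<Longrightarrow> x \<in> U \<Longrightarrow> smooth_on f U \<Longrightarrow> partial j (partial i f) x = partial i (partial j f) x"
  unfolding smooth_on_def by (blast intro: partial_commute)

section \<open>The divergence of the Newton tensors of A(v)\<close>

context
  fixes v :: "real ^ 'n \<Rightarrow> real" and U :: "(real ^ 'n) set" and x :: "real ^ 'n"
  assumes U: "open U" "x \<in> U" and smooth: "smooth_on v U" and pos: "0 < v x"
begin

private abbreviation (input) g where "g \<equiv> grad v x"
private abbreviation (input) W where "W \<equiv> A_mat v x"
private abbreviation (input) H where "H i j \<equiv> partial j (partial i v) x"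

lemma hessian_sym: "H i j = H j i"
  using U smooth by (rule smooth_on_partial_commute)

lemma hessian_eq: "v x * H i j = W $ i $ j + (if i = j then (norm g)\<^sup>2 / 2 else 0)"
  by (simp add: A_mat_def)

lemma W_sym: "W $ i $ j = W $ j $ i"
  using hessian_eq[of i j] hessian_eq[of j i] hessian_sym[of i j] by (auto split: if_splits)

lemma transpose_W: "transpose W = W"
  by (simp add: transpose_def vec_eq_iff W_sym)

text \<open>Half of the gradient of \<open>|\<nabla>v|\<^sup>2\<close> is \<open>D\<^sup>2v g\<close>, so this is where derivatives of \<open>|\<nabla>v|\<^sup>2\<close> turn into the
  algebra of \<open>W\<close> and \<open>g\<close>.\<close>

lemma W_grad: "(W *v g) $ j = v x * (\<Sum>p\<in>UNIV. g $ p * H p j) - (norm g)\<^sup>2 / 2 * g $ j"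
proof -
  have "v x * (\<Sum>p\<in>UNIV. g $ p * H p j)
      = (\<Sum>p\<in>UNIV. W $ j $ p * g $ p + (if p = j then (norm g)\<^sup>2 / 2 * g $ j else 0))"
    unfolding sum_distrib_left
  proof (rule sum.cong[OF refl])
    fix p
    have "v x * (g $ p * H p j) = g $ p * (v x * H p j)" by simp
    then show "v x * (g $ p * H p j) = W $ j $ p * g $ p + (if p = j then (norm g)\<^sup>2 / 2 * g $ j else 0)"
      unfolding hessian_eq by (simp add: W_sym[of j p] algebra_simps)
  qed
  then show ?thesis by (simp add: sum.distrib matrix_vector_mult_def)
qed

lemma DERIV_v: "((\<lambda>t. v (x + t *\<^sub>R axis j 1)) has_real_derivative g $ j) (at 0)"
  unfolding grad_def using smooth_on_differentiable[OF smooth U(2)]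
  by (simp add: differentiable_has_partial)

lemma DERIV_grad: "((\<lambda>t. partial i v (x + t *\<^sub>R axis j 1)) has_real_derivative H i j) (at 0)"
  by (intro differentiable_has_partial smooth_on_differentiable[OF _ U(2)] smooth_on_partial smooth)

lemma DERIV_hessian:
  "((\<lambda>t. partial j (partial i v) (x + t *\<^sub>R axis l 1)) has_real_derivative
    partial l (partial j (partial i v)) x) (at 0)"
  by (intro differentiable_has_partial smooth_on_differentiable[OF _ U(2)] smooth_on_partial smooth)

lemma norm_grad_power2: "(norm (grad v y))\<^sup>2 = (\<Sum>p\<in>UNIV. (partial p v y)\<^sup>2)"
  by (simp only: power2_norm_eq_inner) (simp add: inner_vec_def grad_def power2_eq_square)

lemma DERIV_norm_grad_power2:
  "((\<lambda>t. (norm (grad v (x + t *\<^sub>R axis j 1)))\<^sup>2) has_real_derivative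
    2 * (\<Sum>p\<in>UNIV. g $ p * H p j)) (at 0)"
proof -
  have "((\<lambda>t. (partial p v (x + t *\<^sub>R axis j 1))\<^sup>2) has_real_derivative 2 * (g $ p * H p j)) (at 0)" for p
    by (rule DERIV_cong[OF DERIV_power[OF DERIV_grad]]) (simp add: grad_def)
  then show ?thesis
    unfolding norm_grad_power2 sum_distrib_left by (intro DERIV_sum)
qed

text \<open>The matrix \<open>\<partial>\<^sub>l A(v)\<close> at \<open>x\<close>, written out by the product rule (see \<open>DERIV_A_mat\<close>) so that the
  symmetry of the third derivatives can be applied.\<close>

definition A_mat_partial :: "'n \<Rightarrow> real ^ 'n ^ 'n" where
  "A_mat_partial l = (\<chi> i j. g $ l * H i j + v x * partial l (partial j (partial i v)) x
    - (if i = j then \<Sum>p\<in>UNIV. g $ p * H p l else 0))"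

lemma DERIV_A_mat: "((\<lambda>t. A_mat v (x + t *\<^sub>R axis l 1) $ i $ j) has_real_derivative A_mat_partial l $ i $ j) (at 0)"
  unfolding A_mat_def A_mat_partial_def vec_lambda_beta
  by (rule DERIV_cong, rule DERIV_diff, rule DERIV_mult[OF DERIV_v DERIV_hessian],
      rule DERIV_cmult_right[OF DERIV_cmult[OF DERIV_norm_grad_power2]]) simp

text \<open>The third derivatives cancel by symmetry. Substituting \<open>v D\<^sup>2v = W + (|g|\<^sup>2/2) I\<close> leaves four
  multiples of \<open>|g|\<^sup>2\<close>: two from the products \<open>g\<^sub>l v\<^sub>i\<^sub>j\<close>, two from the derivatives of the trace part. They
  cancel in pairs.\<close>

lemma codazzi_defect:
  "v x * (A_mat_partial l $ i $ j - A_mat_partial j $ i $ l) = g $ l * W $ i $ j - g $ j * W $ i $ l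
    - (if i = j then (W *v g) $ l else 0) + (if i = l then (W *v g) $ j else 0)"
proof -
  have third: "partial l (partial j (partial i v)) x = partial j (partial l (partial i v)) x"
    using U smooth_on_partial[OF smooth] by (rule smooth_on_partial_commute)
  have "v x * (A_mat_partial l $ i $ j - A_mat_partial j $ i $ l)
    = g $ l * (v x * H i j) - g $ j * (v x * H i l)
      - (if i = j then v x * (\<Sum>p\<in>UNIV. g $ p * H p l) else 0)
      + (if i = l then v x * (\<Sum>p\<in>UNIV. g $ p * H p j) else 0)"
    by (simp add: A_mat_partial_def third algebra_simps)
  then show ?thesis
    unfolding hessian_eq W_grad
    by (cases "i = j"; cases "i = l") (simp_all add: algebra_simps)
qed

lemma DERIV_newton_tensor:
  assumes "m \<le> CARD('n)"
  shows "((\<lambda>t. newton_tensor m (A_mat v (x + t *\<^sub>R axis l 1)) $ i $ j) has_real_derivative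
    partial l (\<lambda>y. newton_tensor m (A_mat v y) $ i $ j) x) (at 0)"
proof -
  have "(\<lambda>t. newton_tensor m (A_mat v (x + t *\<^sub>R axis l 1)) $ i $ j) differentiable (at 0)"
    by (rule newton_tensor_path_differentiable[OF assms DERIV_A_mat])
  then obtain d where d: "((\<lambda>t. newton_tensor m (A_mat v (x + t *\<^sub>R axis l 1)) $ i $ j)
      has_real_derivative d) (at 0)"
    using real_differentiableE by blast
  moreover have "partial l (\<lambda>y. newton_tensor m (A_mat v y) $ i $ j) x = d"
    by (rule partial_eqI[OF d])
  ultimately show ?thesis by simp
qed

text \<open>Write \<open>D\<^sub>m = v div T\<^sub>m\<close>. The divergence of \<open>T\<^sub>m\<^sub>+\<^sub>1 = \<sigma>\<^sub>m\<^sub>+\<^sub>1 I - T\<^sub>m W\<close> contains \<open>T\<^sub>m\<close> contracted with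
  \<open>\<partial>\<^sub>i W\<^sub>l\<^sub>j\<close> from the gradient of \<open>\<sigma>\<^sub>m\<^sub>+\<^sub>1\<close> and with \<open>-\<partial>\<^sub>j W\<^sub>l\<^sub>i\<close> from the product, which is the Codazzi defect.
  As \<open>T\<^sub>m\<close> and \<open>W\<close> are symmetric and commute, two of its four terms cancel, and the traces of \<open>T\<^sub>m\<close> and
  \<open>T\<^sub>m W\<close> give \<open>D\<^sub>m\<^sub>+\<^sub>1 = -W D\<^sub>m + (m + 1) \<sigma>\<^sub>m\<^sub>+\<^sub>1 g - (n - m) \<sigma>\<^sub>m W g\<close>. The stated formula solves this recursion.\<close>

lemma divergence_newton_tensor:
  assumes "m \<le> CARD('n)"
  shows "v x * (\<Sum>j\<in>UNIV. partial j (\<lambda>y. newton_tensor m (A_mat v y) $ j $ i) x)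
    = real CARD('n) * (newton_tensor m W *v g) $ i
      - (real CARD('n) - real m) * sigma_mat m W * g $ i"
  using assms
proof (induction m arbitrary: i)
  case 0
  have "partial j (\<lambda>y. mat 1 $ j $ i) x = 0" for j
    by (rule partial_eqI) simp
  then show ?case by simp
next
  case (Suc m)
  define T where "T = newton_tensor m W"
  define P where "P j a b = partial j (\<lambda>y. newton_tensor m (A_mat v y) $ a $ b) x" for j a b
  have T_sym: "T $ a $ b = T $ b $ a" for a b
    using transpose_newton_tensor[OF transpose_W, of m] unfolding T_def transpose_def
    by (simp add: vec_eq_iff)
  have TW: "T ** W = W ** T" unfolding T_def by (simp add: newton_tensor_commute)
  have dT: "partial j (\<lambda>y. newton_tensor (Suc m) (A_mat v y) $ j $ i) x
      = (if j = i then \<Sum>l\<in>UNIV. \<Sum>k\<in>UNIV. T $ k $ l * A_mat_partial j $ l $ k else 0)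
        - (\<Sum>l\<in>UNIV. P j j l * W $ l $ i + T $ j $ l * A_mat_partial j $ l $ i)" for j
  proof (rule partial_eqI)
    \<comment> \<open>With \<open>T\<^sub>m\<close> on the left of the product, the summed index \<open>j\<close> falls on \<open>T\<^sub>m\<close>, so that its divergence
      appears.\<close>
    have e: "newton_tensor (Suc m) B $ j $ i
        = sigma_mat (Suc m) B * (if j = i then 1 else 0) - (\<Sum>l\<in>UNIV. newton_tensor m B $ j $ l * B $ l $ i)"
      for B :: "real ^ 'n ^ 'n"
      by (simp add: newton_tensor_commute) (simp add: matrix_matrix_mult_def mat_def)
    have s: "((\<lambda>t. sigma_mat (Suc m) (A_mat v (x + t *\<^sub>R axis j 1))) has_real_derivative
        (\<Sum>l\<in>UNIV. \<Sum>k\<in>UNIV. T $ k $ l * A_mat_partial j $ l $ k)) (at 0)"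
      using sigma_mat_path_derivative[OF Suc.prems DERIV_A_mat] by (simp add: T_def)
    have t: "((\<lambda>t. newton_tensor m (A_mat v (x + t *\<^sub>R axis j 1)) $ j $ l
          * A_mat v (x + t *\<^sub>R axis j 1) $ l $ i) has_real_derivative
        P j j l * W $ l $ i + T $ j $ l * A_mat_partial j $ l $ i) (at 0)" for l
      unfolding P_def T_def using Suc.prems
      by (intro DERIV_cong[OF DERIV_mult[OF DERIV_newton_tensor DERIV_A_mat]]) simp_all
    show "((\<lambda>t. newton_tensor (Suc m) (A_mat v (x + t *\<^sub>R axis j 1)) $ j $ i) has_real_derivative
        (if j = i then \<Sum>l\<in>UNIV. \<Sum>k\<in>UNIV. T $ k $ l * A_mat_partial j $ l $ k else 0)
        - (\<Sum>l\<in>UNIV. P j j l * W $ l $ i + T $ j $ l * A_mat_partial j $ l $ i)) (at 0)"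
      unfolding e
      by (intro DERIV_diff DERIV_sum t DERIV_cong[OF DERIV_cmult_right[OF s]]) simp
  qed
  have "(\<Sum>j\<in>UNIV. partial j (\<lambda>y. newton_tensor (Suc m) (A_mat v y) $ j $ i) x)
    = (\<Sum>l\<in>UNIV. \<Sum>j\<in>UNIV. T $ j $ l * A_mat_partial i $ l $ j)
      - (\<Sum>j\<in>UNIV. \<Sum>l\<in>UNIV. P j j l * W $ l $ i + T $ j $ l * A_mat_partial j $ l $ i)"
    unfolding dT sum_subtractf by simp
  also have "(\<Sum>l\<in>UNIV. \<Sum>j\<in>UNIV. T $ j $ l * A_mat_partial i $ l $ j)
    = (\<Sum>j\<in>UNIV. \<Sum>l\<in>UNIV. T $ j $ l * A_mat_partial i $ l $ j)" by (rule sum.swap)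
  also have "(\<Sum>j\<in>UNIV. \<Sum>l\<in>UNIV. P j j l * W $ l $ i + T $ j $ l * A_mat_partial j $ l $ i)
    = (\<Sum>l\<in>UNIV. (\<Sum>j\<in>UNIV. P j j l) * W $ l $ i)
      + (\<Sum>j\<in>UNIV. \<Sum>l\<in>UNIV. T $ j $ l * A_mat_partial j $ l $ i)"
    by (simp add: sum.distrib sum_distrib_right) (rule sum.swap)
  finally have "v x * (\<Sum>j\<in>UNIV. partial j (\<lambda>y. newton_tensor (Suc m) (A_mat v y) $ j $ i) x)
    = (\<Sum>j\<in>UNIV. \<Sum>l\<in>UNIV. T $ j $ l * (v x * (A_mat_partial i $ l $ j - A_mat_partial j $ l $ i)))
      - (\<Sum>l\<in>UNIV. (v x * (\<Sum>j\<in>UNIV. P j j l)) * W $ l $ i)"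
    by (simp add: right_diff_distrib distrib_left sum_subtractf sum_distrib_left mult_ac)
  also have "(\<Sum>l\<in>UNIV. (v x * (\<Sum>j\<in>UNIV. P j j l)) * W $ l $ i)
    = real CARD('n) * (W *v (T *v g)) $ i
      - (real CARD('n) - real m) * sigma_mat m W * (W *v g) $ i"
  proof -
    have IH: "v x * (\<Sum>j\<in>UNIV. P j j l) = real CARD('n) * (T *v g) $ l
      - (real CARD('n) - real m) * sigma_mat m W * g $ l" for l
      unfolding P_def T_def using Suc by simp
    have "(\<Sum>l\<in>UNIV. (c * (T *v g) $ l - d * g $ l) * W $ l $ i)
      = c * (W *v (T *v g)) $ i - d * (W *v g) $ i" for c d
      unfolding matrix_vector_mult_def[of W]
      by (simp add: sum_subtractf sum_distrib_left W_sym[of _ i] algebra_simps)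
    then show ?thesis unfolding IH .
  qed
  also have "(\<Sum>j\<in>UNIV. \<Sum>l\<in>UNIV. T $ j $ l * (v x * (A_mat_partial i $ l $ j - A_mat_partial j $ l $ i)))
    = g $ i * trace (T ** W) - (W *v (T *v g)) $ i - (W *v g) $ i * trace T + (T *v (W *v g)) $ i"
  proof -
    have 1: "(\<Sum>j\<in>UNIV. \<Sum>l\<in>UNIV. T $ j $ l * (g $ i * W $ l $ j)) = g $ i * trace (T ** W)"
      by (simp add: trace_def matrix_matrix_mult_def sum_distrib_left mult_ac)
    have "(\<Sum>j\<in>UNIV. \<Sum>l\<in>UNIV. T $ j $ l * (g $ j * W $ l $ i))
        = (\<Sum>l\<in>UNIV. \<Sum>j\<in>UNIV. T $ j $ l * (g $ j * W $ l $ i))" by (rule sum.swap)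
    also have "\<dots> = (W *v (T *v g)) $ i"
      by (simp add: matrix_vector_mult_def sum_distrib_left W_sym[of _ i] T_sym[of _ l for l] mult_ac)
    finally have 2: "(\<Sum>j\<in>UNIV. \<Sum>l\<in>UNIV. T $ j $ l * (g $ j * W $ l $ i)) = (W *v (T *v g)) $ i" .
    have 3: "(\<Sum>j\<in>UNIV. \<Sum>l\<in>UNIV. T $ j $ l * (if l = j then (W *v g) $ i else 0)) = (W *v g) $ i * trace T"
      by (simp add: trace_def sum_distrib_right if_distrib mult_ac cong: if_cong)
    have 4: "(\<Sum>j\<in>UNIV. \<Sum>l\<in>UNIV. T $ j $ l * (if l = i then (W *v g) $ j else 0)) = (T *v (W *v g)) $ i"
      by (simp add: matrix_vector_mult_def[of T] T_sym[of _ i] if_distrib cong: if_cong)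
    show ?thesis
      unfolding codazzi_defect unfolding distrib_left right_diff_distrib sum.distrib sum_subtractf 1 2 3 4 ..
  qed
  also have "T *v (W *v g) = W *v (T *v g)" by (simp add: matrix_vector_mul_assoc TW)
  also have "trace (T ** W) = real (Suc m) * sigma_mat (Suc m) W"
    unfolding TW unfolding T_def by (rule newton_identity[OF Suc.prems])
  also have "trace T = (real CARD('n) - real m) * sigma_mat m W"
    unfolding T_def using Suc.prems by (intro trace_newton_tensor) simp
  finally show ?case
    by (simp add: matrix_vector_mult_diff_rdistrib matrix_vector_mul_assoc T_def
      flip: scaleR_matrix_vector_assoc) (simp add: algebra_simps)
qed

text \<open>The four terms of the product rule are evaluated in \<open>s1\<close> to \<open>s4\<close>. The term \<open>Q (Suc m)\<close> arises from
  differentiating the weight \<open>|\<nabla>v|\<^bsup>2l\<^esup>\<close>, which produces \<open>\<langle>W g, T\<^sub>m g\<rangle> = \<sigma>\<^sub>m\<^sub>+\<^sub>1 |g|\<^sup>2 - Q (Suc m)\<close> by the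
  recursion for \<open>T\<^sub>m\<^sub>+\<^sub>1\<close>. For \<open>l = 0\<close> the truncated exponent \<open>l - 1\<close> is harmless, being multiplied by \<open>l\<close>.\<close>

lemma divergence_weighted:
  fixes \<alpha> :: real and l m :: nat
  assumes m: "Suc m \<le> CARD('n)"
  defines "p \<equiv> (norm g)\<^sup>2" and "Q \<equiv> \<lambda>m. g \<bullet> (newton_tensor m W *v g)"
  shows "(\<Sum>j\<in>UNIV. partial j (\<lambda>y. \<Sum>i\<in>UNIV. v y powr (\<alpha> + 1) * norm (grad v y) ^ (2 * l)
      * newton_tensor m (A_mat v y) $ j $ i * partial i v y) x)
    = v x powr \<alpha> * ((\<alpha> + 1 + real CARD('n) + real l) * p ^ l * Q m
      - 2 * real l * p ^ (l - 1) * Q (Suc m)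
      + (2 * real l + real m + 1) * p ^ l * sigma_mat (Suc m) W
      - (real CARD('n) - real m) / 2 * p ^ (l + 1) * sigma_mat m W)"
proof -
  define T where "T = newton_tensor m W"
  define P where "P j i = partial j (\<lambda>y. newton_tensor m (A_mat v y) $ j $ i) x" for j i
  have m': "m \<le> CARD('n)" using m by simp
  have T_sym: "T $ a $ b = T $ b $ a" for a b
    using transpose_newton_tensor[OF transpose_W, of m] unfolding T_def transpose_def
    by (simp add: vec_eq_iff)
  have TW: "T ** W = W ** T" unfolding T_def by (simp add: newton_tensor_commute)
  have powr: "v x powr (\<alpha> + 1) = v x powr \<alpha> * v x" using pos by (simp add: powr_add)
  have gi: "partial i v x = g $ i" for i by (simp add: grad_def)
  have D: "partial j (\<lambda>y. \<Sum>i\<in>UNIV. v y powr (\<alpha> + 1) * norm (grad v y) ^ (2 * l)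
      * newton_tensor m (A_mat v y) $ j $ i * partial i v y) x
    = v x powr \<alpha> * (\<Sum>i\<in>UNIV. (\<alpha> + 1) * p ^ l * (g $ j * (T $ j $ i * g $ i))
        + 2 * real l * p ^ (l - 1) * (v x * (\<Sum>q\<in>UNIV. g $ q * H q j) * (T $ j $ i * g $ i))
        + p ^ l * (v x * P j i * g $ i) + p ^ l * (T $ j $ i * (v x * H i j)))" for j
  proof -
    have 1: "((\<lambda>t. v (x + t *\<^sub>R axis j 1) powr (\<alpha> + 1)) has_real_derivative
        (\<alpha> + 1) * v x powr \<alpha> * g $ j) (at 0)"
      using DERIV_fun_powr[OF DERIV_v, where r = "\<alpha> + 1"] pos by simp
    have 2: "((\<lambda>t. norm (grad v (x + t *\<^sub>R axis j 1)) ^ (2 * l)) has_real_derivative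
        real l * p ^ (l - 1) * (2 * (\<Sum>q\<in>UNIV. g $ q * H q j))) (at 0)"
      unfolding power_mult p_def
      by (rule DERIV_cong[OF DERIV_power[OF DERIV_norm_grad_power2]]) simp
    have 3: "((\<lambda>t. v (x + t *\<^sub>R axis j 1) powr (\<alpha> + 1) * norm (grad v (x + t *\<^sub>R axis j 1)) ^ (2 * l)
      * newton_tensor m (A_mat v (x + t *\<^sub>R axis j 1)) $ j $ i * partial i v (x + t *\<^sub>R axis j 1))
      has_real_derivative v x powr \<alpha> * ((\<alpha> + 1) * p ^ l * (g $ j * (T $ j $ i * g $ i))
        + 2 * real l * p ^ (l - 1) * (v x * (\<Sum>q\<in>UNIV. g $ q * H q j) * (T $ j $ i * g $ i))
        + p ^ l * (v x * P j i * g $ i) + p ^ l * (T $ j $ i * (v x * H i j)))) (at 0)" for i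
      by (rule DERIV_cong[OF DERIV_mult[OF DERIV_mult[OF DERIV_mult[OF 1 2]
              DERIV_newton_tensor[OF m']] DERIV_grad]])
         (simp add: powr power_mult gi flip: p_def P_def T_def, simp add: algebra_simps)
    show ?thesis
      unfolding sum_distrib_left[of "v x powr \<alpha>"] by (intro partial_eqI DERIV_sum 3)
  qed
  have s1: "(\<Sum>j\<in>UNIV. \<Sum>i\<in>UNIV. g $ j * (T $ j $ i * g $ i)) = Q m"
    by (simp add: Q_def T_def inner_vec_def matrix_vector_mult_def sum_distrib_left)
  have s2: "(\<Sum>j\<in>UNIV. \<Sum>i\<in>UNIV. v x * (\<Sum>q\<in>UNIV. g $ q * H q j) * (T $ j $ i * g $ i))
      = p * sigma_mat (Suc m) W - Q (Suc m) + p / 2 * Q m"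
  proof -
    have "(\<Sum>j\<in>UNIV. \<Sum>i\<in>UNIV. v x * (\<Sum>q\<in>UNIV. g $ q * H q j) * (T $ j $ i * g $ i))
      = (\<Sum>j\<in>UNIV. ((W *v g) $ j + p / 2 * g $ j) * (T *v g) $ j)"
      by (simp add: W_grad p_def matrix_vector_mult_def[of T] sum_distrib_left)
    also have "\<dots> = (W *v g) \<bullet> (T *v g) + p / 2 * Q m"
      by (simp add: inner_vec_def Q_def T_def sum.distrib sum_distrib_left algebra_simps)
    also have "(W *v g) \<bullet> (T *v g) = g \<bullet> (W *v (T *v g))"
      by (metis dot_lmul_matrix transpose_W vector_transpose_matrix)
    also have "\<dots> = p * sigma_mat (Suc m) W - Q (Suc m)"
      unfolding Q_def p_def
      by (simp add: matrix_vector_mult_diff_rdistrib matrix_vector_mul_assoc T_def inner_diff_right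
          power2_norm_eq_inner flip: scaleR_matrix_vector_assoc)
    finally show ?thesis .
  qed
  have s3: "(\<Sum>j\<in>UNIV. \<Sum>i\<in>UNIV. v x * P j i * g $ i)
      = real CARD('n) * Q m - (real CARD('n) - real m) * sigma_mat m W * p"
  proof -
    have "(\<Sum>j\<in>UNIV. \<Sum>i\<in>UNIV. v x * P j i * g $ i)
        = (\<Sum>i\<in>UNIV. v x * (\<Sum>j\<in>UNIV. P j i) * g $ i)"
      by (simp add: sum_distrib_left sum_distrib_right) (rule sum.swap)
    also have "\<dots> = (\<Sum>i\<in>UNIV. (real CARD('n) * (T *v g) $ i
        - (real CARD('n) - real m) * sigma_mat m W * g $ i) * g $ i)"
      unfolding P_def T_def divergence_newton_tensor[OF m'] ..
    also have "\<dots> = real CARD('n) * (g \<bullet> (T *v g)) - (real CARD('n) - real m) * sigma_mat m W * (g \<bullet> g)"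
      unfolding inner_vec_def left_diff_distrib sum_subtractf sum_distrib_left
      by (simp add: mult_ac)
    finally show ?thesis by (simp add: Q_def T_def p_def power2_norm_eq_inner)
  qed
  have s4: "(\<Sum>j\<in>UNIV. \<Sum>i\<in>UNIV. T $ j $ i * (v x * H i j))
      = (real m + 1) * sigma_mat (Suc m) W + p / 2 * ((real CARD('n) - real m) * sigma_mat m W)"
  proof -
    have "(\<Sum>j\<in>UNIV. \<Sum>i\<in>UNIV. T $ j $ i * (v x * H i j)) = trace (T ** W) + p / 2 * trace T"
      unfolding hessian_eq distrib_left sum.distrib
      by (simp add: trace_def matrix_matrix_mult_def sum_distrib_left sum_distrib_right p_def
          if_distrib[of "\<lambda>z. _ * z"] mult_ac cong: if_cong)
    then show ?thesis
      unfolding TW unfolding T_def newton_identity[OF m] trace_newton_tensor[OF m'] by simp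
  qed
  have "(\<Sum>j\<in>UNIV. partial j (\<lambda>y. \<Sum>i\<in>UNIV. v y powr (\<alpha> + 1) * norm (grad v y) ^ (2 * l)
      * newton_tensor m (A_mat v y) $ j $ i * partial i v y) x)
    = v x powr \<alpha> * ((\<alpha> + 1) * p ^ l * Q m
        + 2 * real l * p ^ (l - 1) * (p * sigma_mat (Suc m) W - Q (Suc m) + p / 2 * Q m)
        + p ^ l * (real CARD('n) * Q m - (real CARD('n) - real m) * sigma_mat m W * p)
        + p ^ l * ((real m + 1) * sigma_mat (Suc m) W
            + p / 2 * ((real CARD('n) - real m) * sigma_mat m W)))"
    unfolding D sum_distrib_left[symmetric] sum.distrib s3 s4
      s1[unfolded sum_distrib_left[symmetric]] s2[unfolded sum_distrib_left[symmetric]] ..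
  also have "2 * real l * p ^ (l - 1) * (p * sigma_mat (Suc m) W - Q (Suc m) + p / 2 * Q m)
      = 2 * real l * p ^ l * sigma_mat (Suc m) W - 2 * real l * p ^ (l - 1) * Q (Suc m)
        + real l * p ^ l * Q m"
    by (cases l) (simp_all add: algebra_simps)
  also have "(\<alpha> + 1) * p ^ l * Q m
        + (2 * real l * p ^ l * sigma_mat (Suc m) W - 2 * real l * p ^ (l - 1) * Q (Suc m)
          + real l * p ^ l * Q m)
        + p ^ l * (real CARD('n) * Q m - (real CARD('n) - real m) * sigma_mat m W * p)
        + p ^ l * ((real m + 1) * sigma_mat (Suc m) W
            + p / 2 * ((real CARD('n) - real m) * sigma_mat m W))
      = (\<alpha> + 1 + real CARD('n) + real l) * p ^ l * Q m - 2 * real l * p ^ (l - 1) * Q (Suc m)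
      + (2 * real l + real m + 1) * p ^ l * sigma_mat (Suc m) W
      - (real CARD('n) - real m) / 2 * p ^ (l + 1) * sigma_mat m W"
    by (simp add: field_simps)
  finally show ?thesis .
qed

end

section \<open>The divergence identity\<close>

theorem lemma3p1:
  fixes k :: nat and \<alpha> :: real
  assumes "1 \<le> k" and "k \<le> CARD('n::finite)" and "CARD('n) \<ge> 3"
  shows "\<exists>a b :: nat \<Rightarrow> real. a 0 = - 1 \<and>
    (\<forall>(\<Omega> :: (real ^ 'n) set) (v :: real ^ 'n \<Rightarrow> real).
       open \<Omega> \<and> connected \<Omega> \<and> \<Omega> \<noteq> {} \<and> smooth_on v \<Omega> \<and> (\<forall>x\<in>\<Omega>. v x > 0) \<longrightarrow>
       (\<forall>x\<in>\<Omega>.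
          (\<Sum>l<k. a l * (\<Sum>j\<in>UNIV. partial j (\<lambda>y. \<Sum>i\<in>UNIV.
               v y powr (\<alpha> + 1) * norm (grad v y) ^ (2 * l)
               * S_deriv (k - l) i j v y * partial i v y) x))
          + (\<Sum>l\<le>k. b l * v x powr \<alpha> * norm (grad v x) ^ (2 * l) * S (k - l) v x) = 0))"
proof -
  let ?n = "real CARD('n)"
  \<comment> \<open>\<open>a\<close> solves the recursion \<open>a_rec\<close> that makes the quadratic forms telescope; \<open>b l\<close> collects the terms
    \<open>|\<nabla>v|\<^bsup>2l\<^esup> S (k - l)\<close>, which come from the divergences with index \<open>l\<close> and \<open>l - 1\<close>. The recursion also
    defines \<open>a k\<close>, which occurs in \<open>b k\<close> only and accounts for the end of the telescope.\<close>
  define a where "a l = - (\<Prod>s<l. (\<alpha> + 1 + ?n + real s) / (2 * real (Suc s)))" for l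
  define b where "b l = (case l of 0 \<Rightarrow> 0 | Suc l' \<Rightarrow> (?n - real k + real l) / 2 * a l')
    - (real k + real l) * a l" for l
  have a_rec: "2 * real (Suc l) * a (Suc l) = (\<alpha> + 1 + ?n + real l) * a l" for l
    by (simp add: a_def del: of_nat_Suc)
  have main: "(\<Sum>l<k. a l * (\<Sum>j\<in>UNIV. partial j (\<lambda>y. \<Sum>i\<in>UNIV.
               v y powr (\<alpha> + 1) * norm (grad v y) ^ (2 * l)
               * S_deriv (k - l) i j v y * partial i v y) x))
          + (\<Sum>l\<le>k. b l * v x powr \<alpha> * norm (grad v x) ^ (2 * l) * S (k - l) v x) = 0"
    if v: "open \<Omega>" "smooth_on v \<Omega>" "\<And>x. x \<in> \<Omega> \<Longrightarrow> v x > 0" "x \<in> \<Omega>"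
    for \<Omega> :: "(real ^ 'n) set" and v x
  proof -
    define p where "p = (norm (grad v x))\<^sup>2"
    define Q where "Q m = grad v x \<bullet> (newton_tensor m (A_mat v x) *v grad v x)" for m
    define G where "G l = p ^ l * S (k - l) v x" for l
    define E where "E l = (\<Sum>j\<in>UNIV. partial j (\<lambda>y. \<Sum>i\<in>UNIV.
               v y powr (\<alpha> + 1) * norm (grad v y) ^ (2 * l)
               * S_deriv (k - l) i j v y * partial i v y) x)" for l
    have E: "E l = v x powr \<alpha> * ((\<alpha> + 1 + ?n + real l) * p ^ l * Q (k - Suc l)
        - 2 * real l * p ^ (l - 1) * Q (k - l) + (real k + real l) * G l
        - (?n - real k + real l + 1) / 2 * G (Suc l))" if l: "l < k" for l
    proof -
      have kl: "k - l = Suc (k - Suc l)" "Suc (k - Suc l) \<le> CARD('n)"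
        using l assms by auto
      have r: "real (k - Suc l) = real k - real l - 1" using l by (simp add: of_nat_diff)
      have "S_deriv (k - l) i j v y = newton_tensor (k - Suc l) (A_mat v y) $ j $ i" for i j y
        unfolding kl(1) S_deriv_def by (rule sigma_mat_deriv_eq_newton_tensor[OF kl(2)])
      then have "E l = v x powr \<alpha> * ((\<alpha> + 1 + ?n + real l) * p ^ l * Q (k - Suc l)
      - 2 * real l * p ^ (l - 1) * Q (Suc (k - Suc l))
      + (2 * real l + real (k - Suc l) + 1) * p ^ l * sigma_mat (Suc (k - Suc l)) (A_mat v x)
      - (?n - real (k - Suc l)) / 2 * p ^ (l + 1) * sigma_mat (k - Suc l) (A_mat v x))"
        unfolding E_def p_def Q_def
        by (simp only: divergence_weighted[OF v(1,4,2) v(3)[OF v(4)] kl(2)])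
      then show ?thesis
        by (simp only: r flip: kl(1)) (simp add: G_def S_def algebra_simps)
    qed
    have telescope: "(\<Sum>l<N. a l * E l) = v x powr \<alpha> * (2 * real N * a N * (p ^ (N - 1) * Q (k - N))
        + (\<Sum>l<N. a l * ((real k + real l) * G l - (?n - real k + real l + 1) / 2 * G (Suc l))))"
      if "N \<le> k" for N
      using that
    proof (induction N)
      case (Suc N)
      have "(\<Sum>l<Suc N. a l * E l) = v x powr \<alpha> * (((\<alpha> + 1 + ?n + real N) * a N) * (p ^ N * Q (k - Suc N))
        + (\<Sum>l<Suc N. a l * ((real k + real l) * G l - (?n - real k + real l + 1) / 2 * G (Suc l))))"
        using Suc by (simp add: E algebra_simps)
      then show ?case unfolding a_rec[symmetric] by simp
    qed simp
    have Q0: "p ^ (k - 1) * Q 0 = G k"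
      using assms(1) by (cases k) (simp_all add: Q_def G_def p_def S_def power2_norm_eq_inner)
    have "(\<Sum>l\<le>k. b l * G l) = (\<Sum>l<k. (?n - real k + real (Suc l)) / 2 * a l * G (Suc l))
        - (\<Sum>l\<le>k. (real k + real l) * a l * G l)"
      unfolding b_def left_diff_distrib sum_subtractf
      unfolding lessThan_Suc_atMost[symmetric]
      by (subst sum.lessThan_Suc_shift) simp
    also have "\<dots> = - (2 * real k * a k * G k
        + (\<Sum>l<k. a l * ((real k + real l) * G l - (?n - real k + real l + 1) / 2 * G (Suc l))))"
      by (simp add: sum_subtractf right_diff_distrib mult_ac add_ac flip: lessThan_Suc_atMost)
    finally have bG: "(\<Sum>l\<le>k. b l * G l) = - (2 * real k * a k * G k
        + (\<Sum>l<k. a l * ((real k + real l) * G l - (?n - real k + real l + 1) / 2 * G (Suc l))))" .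
    have "(\<Sum>l\<le>k. b l * v x powr \<alpha> * norm (grad v x) ^ (2 * l) * S (k - l) v x)
        = v x powr \<alpha> * (\<Sum>l\<le>k. b l * G l)"
      unfolding power_mult by (simp add: G_def p_def sum_distrib_left mult_ac)
    moreover have "(\<Sum>l<k. a l * E l) = v x powr \<alpha> * (2 * real k * a k * G k
        + (\<Sum>l<k. a l * ((real k + real l) * G l - (?n - real k + real l + 1) / 2 * G (Suc l))))"
      using telescope[of k] Q0 by simp
    ultimately show ?thesis
      unfolding E_def[symmetric] bG by (simp only: mult_minus_right add.right_inverse)
  qed
  have "a 0 = - 1" by (simp add: a_def)
  with main show ?thesis by blast
qed

end
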